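(* Suppose that $p\in L_\infty(0,T)$, $\Phi\in L_\infty(0,\ell)$, $f\in L_\infty(D)$. For $[g]_n\in\mathcal{G}_R^n$ and $n,m$ large enough, the discrete state vector $[v([g]_n)]_n$ satisfies $$\|[v]_n\|_{\ell_\infty}:=\max_{0\le k\le n}\Big(\max_{0\le i\le m}|v_i(k)|\Big)\le C_\infty\Big(\|f\|_{L_\infty(D)}+\|p\|_{L_\infty(0,T)}+\|g^n\|_{W_2^1(0,T)}+\|\Phi\|_{L_\infty(0,\ell)}\Big),$$ where $g^n=\mathcal{P}_n([g]_n)$ and $C_\infty$ is a constant independent of $n$ and $m$.
   Context: **Data.** Fix $\ell,T,R>0$, $D=\{(x,t):0<x<\ell,\ 0<t\le T\}$, $J\ge1$, real numbers $u^1<\dots<u^J$, and positive numbers $\gamma_1,\dots,\gamma_J$. The functions $\alpha,k$ are positive and $C^1$ on each of the segments $(-\infty,u^1]$, $[u^j,u^{j+1}]$ ($j=1,\dots,J-1$), $[u^J,+\infty)$, with discontinuities of the first kind (jumps) at $u=u^j$, and satisfy $\int_{u^1}^{\infty}k(u)\,du=\infty$ and $\liminf_{u\to\infty}\alpha(u)/k(u)\ge a_0>0$. Put $F(u)=\int_{u^1}^{u}k(y)\,dy$, $v^j=F(u^j)$, $\beta(v)=\alpha(F^{-1}(v))/k(F^{-1}(v))$. Let $b$ be a function with $b'(v)=\beta(v)$ for $v\ne v^j$ and with jumps $b(v^j)^+-b(v^j)^-=\gamma_j$. The domain of $b$ is $\mathbb{R}$ and there is $\bar b>0$ with $b'(v)\ge\bar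 b$ for $v\ne v^j$ (and $b_n'(v)\ge\bar b$ for all $v$, with $b_n$ defined below). Standing assumption: each level set $\{x\in[0,\ell]:\Phi(x)=v^j\}$ has one-dimensional Lebesgue measure zero. The value $\Phi(\ell)$ used below satisfies $|\Phi(\ell)|\le\|\Phi\|_{L_\infty(0,\ell)}$. **Norm.** $\|g\|_{W_2^1(0,T)}^2=\int_0^T(g^2+(g')^2)\,dt$. **Discretization.** For integers $n,m\ge1$ let $\tau=T/n$, $t_k=k\tau$, $h=\ell/m$, $x_i=ih$; $p_k=\frac1\tau\int_{t_{k-1}}^{t_k}p\,dt$, $g^n_k=\frac1\tau\int_{t_{k-1}}^{t_k}g^n\,dt$; $\Phi_i=\frac1h\int_{x_i}^{x_{i+1}}\Phi\,dx$ ($0\le i\le m-1$), $\Phi_m=\Phi(\ell)$; $f_{ik}=\frac1{\tau h}\int_{t_{k-1}}^{t_k}\int_{x_i}^{x_{i+1}}f\,dx\,dt$. Difference quotients: $w_{ix}=(w_{i+1}-w_i)/h$, and subscript $\bar t$ denotes $(w(k)-w(k-1))/\tau$. For $[g]_n=(g_0,\dots,g_n)\in\mathbb{R}^{n+1}$, $g_{k\bar t}=(g_k-g_{k-1})/\tau$, $\|[g]_n\|_{w_2^1}^2=\sum_{k=1}^n\tau g_k^2+\sum_{k=1}^n\tau g_{k\bar t}^2$, $\mathcal{G}_R^n=\{[g]_n\in\mathbb{R}^{n+1}:\|[g]_n\|_{w_2^1}\le R\}$. $\mathcal{P}_n([g]_n)=g^n$ with $g^n(t)=g_{k-1}+\frac{g_k-g_{k-1}}\tau(t-t_{k-1})$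 for $t\in[t_{k-1},t_k)$, $k=1,\dots,n$. $b_n(v)=\int_{v-1/n}^{v+1/n}b(y)\,\omega_n(v-y)\,dy$ with $\omega_n(v)=C\,n\,e^{-1/(1-n^2v^2)}$ for $|v|<1/n$, $0$ otherwise, $C$ normalizing $\int_{\mathbb R}\omega_1=1$. **Discrete state vector.** Given $[g]_n$, $[v([g]_n)]_n=(v(0),\dots,v(n))$, $v(k)=(v_0(k),\dots,v_m(k))\in\mathbb{R}^{m+1}$, is the discrete state vector if $v_i(0)=\Phi_i$ for $0\le i\le m$ and for each $k=1,\dots,n$ $$\sum_{i=0}^{m-1}h\Big[\big(b_n(v_i(k))\big)_{\bar t}\,\eta_i+v_{ix}(k)\eta_{ix}-f_{ik}\eta_i\Big]-p_k\eta_m+g_k^n\eta_0=0\qquad\forall\,\eta=(\eta_0,\dots,\eta_m)\in\mathbb{R}^{m+1}.$$ *)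

theory Defs
  imports "HOL-Analysis.Analysis" "HOL-Probability.Essential_Supremum"
begin

definition Linf_norm :: "'a::euclidean_space set \<Rightarrow> ('a \<Rightarrow> real) \<Rightarrow> real" where
  "Linf_norm S f = real_of_ereal (esssup (lebesgue_on S) (\<lambda>x. ereal \<bar>f x\<bar>))"

definition in_Linf :: "'a::euclidean_space set \<Rightarrow> ('a \<Rightarrow> real) \<Rightarrow> bool" where
  "in_Linf S f \<longleftrightarrow> f \<in> borel_measurable (lebesgue_on S)
     \<and> esssup (lebesgue_on S) (\<lambda>x. ereal \<bar>f x\<bar>) < \<infinity>"

text \<open>
  The norm of the Sobolev space on \<open>(0,T)\<close>. An element of that space is represented by its
  absolutely continuous version, whose weak derivative is the almost everywhere existing
  classical one.
\<close>
definition W21_norm :: "real \<Rightarrow> (real \<Rightarrow> real) \<Rightarrow> real" where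
  "W21_norm T g = sqrt (LINT t|lebesgue_on {0<..<T}. (g t)\<^sup>2 + (deriv g t)\<^sup>2)"

definition segments :: "nat \<Rightarrow> (nat \<Rightarrow> real) \<Rightarrow> real set set" where
  "segments J u = {{..u 1}, {u J..}} \<union> {{u j..u (j + 1)} |j. 1 \<le> j \<and> j < J}"

text \<open>
  Neighbouring segments share the breakpoint \<open>u j\<close>, where a function with a jump cannot coincide
  with both of its positive \<open>C\<^sup>1\<close> pieces. So the pieces \<open>r\<close> live on the closed segments
  (with one-sided derivatives at end points), and the value of \<open>q\<close> at the breakpoints is left free.
\<close>
definition piecewise_C1_pos :: "nat \<Rightarrow> (nat \<Rightarrow> real) \<Rightarrow> (real \<Rightarrow> real) \<Rightarrow> bool" where
  "piecewise_C1_pos J u q \<longleftrightarrow>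
     (\<forall>S \<in> segments J u. \<exists>r r'.
        (\<forall>x\<in>S. r x > 0 \<and> (r has_real_derivative r' x) (at x within S))
        \<and> continuous_on S r' \<and> (\<forall>x\<in>interior S. q x = r x))"

definition has_jump :: "(real \<Rightarrow> real) \<Rightarrow> real \<Rightarrow> real \<Rightarrow> bool" where
  "has_jump q x d \<longleftrightarrow>
     (\<exists>l r. (q \<longlongrightarrow> l) (at_left x) \<and> (q \<longlongrightarrow> r) (at_right x) \<and> r - l = d)"

definition F_fun :: "(nat \<Rightarrow> real) \<Rightarrow> (real \<Rightarrow> real) \<Rightarrow> real \<Rightarrow> real" where
  "F_fun u k x = (LBINT y=ereal (u 1)..ereal x. k y)"

definition beta_fun :: "(nat \<Rightarrow> real) \<Rightarrow> (real \<Rightarrow> real) \<Rightarrow> (real \<Rightarrow> real) \<Rightarrow> real \<Rightarrow> real" where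
  "beta_fun u \<alpha> k y = \<alpha> (inv (F_fun u k) y) / k (inv (F_fun u k) y)"

definition mollifier_const :: real where
  "mollifier_const = 1 / (LINT y|lebesgue_on {-1<..<1}. exp (- 1 / (1 - y\<^sup>2)))"

definition mollifier :: "nat \<Rightarrow> real \<Rightarrow> real" where
  "mollifier n y =
     (if \<bar>y\<bar> < 1 / real n
      then mollifier_const * real n * exp (- 1 / (1 - (real n)\<^sup>2 * y\<^sup>2)) else 0)"

definition mollify :: "(real \<Rightarrow> real) \<Rightarrow> nat \<Rightarrow> real \<Rightarrow> real" where
  "mollify b n z =
     (LINT y|lebesgue_on {z - 1 / real n..z + 1 / real n}. b y * mollifier n (z - y))"

text \<open>
  Average over the grid cell \<open>[j d, (j + 1) d]\<close>. Time averages with index \<open>k \<ge> 1\<close>, taken over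
  \<open>[(k - 1) \<tau>, k \<tau>]\<close>, are cell averages with \<open>j = k - 1\<close>.
\<close>
definition cell_avg :: "real \<Rightarrow> (real \<Rightarrow> real) \<Rightarrow> nat \<Rightarrow> real" where
  "cell_avg d q j = 1 / d * (LINT s|lebesgue_on {real j * d..(real j + 1) * d}. q s)"

definition control_norm :: "real \<Rightarrow> nat \<Rightarrow> (nat \<Rightarrow> real) \<Rightarrow> real" where
  "control_norm T n g = (let \<tau> = T / real n in
     sqrt ((\<Sum>k=1..n. \<tau> * (g k)\<^sup>2) + (\<Sum>k=1..n. \<tau> * ((g k - g (k - 1)) / \<tau>)\<^sup>2)))"

text \<open>
  Vectors with indices \<open>0,\<dots>,n\<close> are functions on \<open>nat\<close> of which only these values are used.
\<close>
definition control_set :: "real \<Rightarrow> real \<Rightarrow> nat \<Rightarrow> (nat \<Rightarrow> real) set" where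
  "control_set T R n = {g. control_norm T n g \<le> R}"

definition interp :: "real \<Rightarrow> nat \<Rightarrow> (nat \<Rightarrow> real) \<Rightarrow> real \<Rightarrow> real" where
  "interp T n g t = (let \<tau> = T / real n in
     \<Sum>k=1..n. if t \<in> {real (k - 1) * \<tau>..<real k * \<tau>}
       then g (k - 1) + (g k - g (k - 1)) / \<tau> * (t - real (k - 1) * \<tau>) else 0)"

text \<open>The argument \<open>v k i\<close> carries the time index \<open>k \<le> n\<close> first, then the space index \<open>i \<le> m\<close>.\<close>
definition discrete_state_vector ::
  "real \<Rightarrow> real \<Rightarrow> (real \<Rightarrow> real) \<Rightarrow> (real \<Rightarrow> real) \<Rightarrow> (real \<Rightarrow> real) \<Rightarrow> (real \<times> real \<Rightarrow> real)
   \<Rightarrow> nat \<Rightarrow> nat \<Rightarrow> (nat \<Rightarrow> real) \<Rightarrow> (nat \<Rightarrow> nat \<Rightarrow> real) \<Rightarrow> bool" where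
  "discrete_state_vector l T b p \<Phi> f n m g v \<longleftrightarrow>
     (let \<tau> = T / real n; h = l / real m; bn = mollify b n;
          pk = (\<lambda>k. cell_avg \<tau> p (k - 1));
          gk = (\<lambda>k. cell_avg \<tau> (interp T n g) (k - 1));
          fik = (\<lambda>i k. cell_avg \<tau> (\<lambda>t. cell_avg h (\<lambda>x. f (x, t)) i) (k - 1))
      in (\<forall>i<m. v 0 i = cell_avg h \<Phi> i) \<and> v 0 m = \<Phi> l \<and>
         (\<forall>k\<in>{1..n}. \<forall>\<eta> :: nat \<Rightarrow> real.
            (\<Sum>i<m. h * ((bn (v k i) - bn (v (k - 1) i)) / \<tau> * \<eta> i
                        + (v k (i + 1) - v k i) / h * ((\<eta> (i + 1) - \<eta> i) / h)
                        - fik i k * \<eta> i))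
            - pk k * \<eta> m + gk k * \<eta> 0 = 0))"

definition linf_norm :: "nat \<Rightarrow> nat \<Rightarrow> (nat \<Rightarrow> nat \<Rightarrow> real) \<Rightarrow> real" where
  "linf_norm n m v = Max ((\<lambda>k. Max ((\<lambda>i. \<bar>v k i\<bar>) ` {0..m})) ` {0..n})"

end

theory Submission
  imports Defs
begin

text \<open>
  The estimate is a discrete maximum principle. Testing the scheme with unit vectors turns it into
  an implicit finite difference scheme: \<open>b\<^sub>n(v)\<close> is differenced in time, \<open>v\<close> twice in space, the
  flux is \<open>g\<close> at the left end and \<open>p\<close> at the right end. What makes the constant uniform is the
  inequality \<open>b\<^sub>n(y) - b\<^sub>n(x) \<ge> b_low (y - x)\<close> for \<open>x \<le> y\<close>: where \<open>v\<close> grows in one time step,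
  \<open>b\<^sub>n(v)\<close> grows at least proportionally, with a factor that does not depend on \<open>n\<close>, although \<open>b\<^sub>n'\<close>
  blows up near the jumps of \<open>b\<close>.

  Let \<open>A\<close>, \<open>M\<close> and \<open>P\<close> bound the initial values, the cell averages of \<open>f\<close>, and the averages of
  both \<open>p\<close> and \<open>g\<close>. The comparison function is
  \<open>w(x,t) = A + B t + P \<phi>(x)\<close> with \<open>\<phi>(x) = (2 / l) (x - l / 2)\<^sup>2\<close>,
  where \<open>\<phi>\<close> (the definition \<open>barrier\<close>) is steep enough at both ends to dominate the boundary fluxes, and
  \<open>B = (M + 4 P / l) / b_low\<close> is large enough for the time growth to dominate \<open>f\<close> and the second
  difference \<open>4 / l\<close> of \<open>\<phi>\<close>. At a point where \<open>v - w\<close> is maximal over the space grid, a positive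
  maximum would force \<open>v\<close> to grow by more than \<open>B \<tau>\<close> in one time step, and the scheme excludes
  that. Hence \<open>v \<le> w\<close> (\<open>discrete_upper_bound\<close>); the scheme solved by \<open>-v\<close> has the same form, with
  \<open>-b\<^sub>n(-y)\<close> in place of \<open>b\<^sub>n(y)\<close>, so that \<open>\<bar>v\<bar> \<le> w\<close> (\<open>discrete_max_bound\<close>).

  It remains to bound the discrete data by the norms of the data. Averages are bounded by essential
  suprema; for \<open>f\<close> this needs Fubini's theorem for null sets (\<open>AE_lebesgue_pair_swap\<close>). The
  averages of \<open>g\<close> are bounded by the Sobolev embedding on an interval (\<open>sup_le_W21_norm\<close>), applied
  to the piecewise linear interpolant.
\<close>

section \<open>Averages and essential suprema\<close>

lemma AE_abs_le_Linf_norm: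
  assumes "in_Linf S f" "S \<in> sets lebesgue"
  shows "AE x in lebesgue. x \<in> S \<longrightarrow> \<bar>f x\<bar> \<le> Linf_norm S f"
proof -
  have meas: "f \<in> borel_measurable (lebesgue_on S)"
    and fin: "esssup (lebesgue_on S) (\<lambda>x. ereal \<bar>f x\<bar>) < \<infinity>"
    using assms(1) by (auto simp: in_Linf_def)
  have "AE x in lebesgue_on S. \<bar>f x\<bar> \<le> Linf_norm S f"
    using esssup_AE[of "\<lambda>x. ereal \<bar>f x\<bar>" "lebesgue_on S"]
  proof eventually_elim
    case (elim x)
    with fin show ?case
      unfolding Linf_norm_def
      by (cases "esssup (lebesgue_on S) (\<lambda>x. ereal \<bar>f x\<bar>)") auto
  qed
  then show ?thesis
    using assms(2) by (subst (asm) AE_restrict_space_iff) auto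
qed

text \<open>
  Only degenerate cases need care: the essential supremum is \<open>- \<infinity>\<close> over a null set, and \<open>\<infinity>\<close> for
  functions that are unbounded or nonmeasurable. Both infinities are sent to \<open>0\<close> by \<open>real_of_ereal\<close>.
\<close>

lemma Linf_norm_nonneg:
  shows "0 \<le> Linf_norm S f"
proof (cases "(\<lambda>x. ereal \<bar>f x\<bar>) \<in> borel_measurable (lebesgue_on S)
    \<and> emeasure (lebesgue_on S) (space (lebesgue_on S)) = 0")
  case True
  then show ?thesis by (simp add: Linf_norm_def esssup_zero_space)
next
  case False
  have "0 \<le> esssup (lebesgue_on S) (\<lambda>x. ereal \<bar>f x\<bar>)"
  proof (cases "(\<lambda>x. ereal \<bar>f x\<bar>) \<in> borel_measurable (lebesgue_on S)")
    case True
    with False have "esssup (lebesgue_on S) (\<lambda>x. 0::ereal) = 0"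
      by (intro esssup_const) auto
    moreover have "esssup (lebesgue_on S) (\<lambda>x. 0::ereal) \<le> esssup (lebesgue_on S) (\<lambda>x. ereal \<bar>f x\<bar>)"
      by (rule esssup_mono) auto
    ultimately show ?thesis by simp
  next
    case False
    then show ?thesis by (simp add: esssup_non_measurable)
  qed
  then show ?thesis by (simp add: Linf_norm_def real_of_ereal_pos)
qed

text \<open>
  A nonintegrable \<open>q\<close> has integral \<open>0\<close>, so its average satisfies every such bound. This lets the lemma
  be applied twice to \<open>f\<close>, first in space and then in time to the resulting averages.
\<close>

lemma abs_cell_avg_le:
  assumes "d > 0" "M \<ge> 0"
    and "AE t in lebesgue. t \<in> {real j * d<..<(real j + 1) * d} \<longrightarrow> \<bar>q t\<bar> \<le> M"
  shows "\<bar>cell_avg d q j\<bar> \<le> M"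
proof -
  define I where "I = {real j * d..(real j + 1) * d}"
  have len: "measure lebesgue I = d" "I \<in> sets lebesgue" "emeasure lebesgue I < \<infinity>"
    using assms(1) by (auto simp: I_def algebra_simps)
  have ae: "AE t in lebesgue_on I. \<bar>q t\<bar> \<le> M"
  proof -
    have "AE t in lebesgue. t \<noteq> real j * d" "AE t in lebesgue. t \<noteq> (real j + 1) * d"
      by (simp_all add: AE_completion_iff AE_lborel_singleton)
    with assms(3) have "AE t in lebesgue. t \<in> I \<longrightarrow> \<bar>q t\<bar> \<le> M"
      by eventually_elim (auto simp: I_def)
    then show ?thesis
      using len by (subst AE_restrict_space_iff) auto
  qed
  have "\<bar>integral\<^sup>L (lebesgue_on I) q\<bar> \<le> M * d"
  proof (cases "integrable (lebesgue_on I) q")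
    case True
    have fm: "finite_measure (lebesgue_on I)"
      using len by (intro finite_measureI) (auto simp: emeasure_restrict_space)
    have ic: "integrable (lebesgue_on I) (\<lambda>_. M)"
      using fm by (rule finite_measure.integrable_const)
    have "\<bar>integral\<^sup>L (lebesgue_on I) q\<bar> \<le> (LINT t|lebesgue_on I. \<bar>q t\<bar>)"
      by (rule integral_abs_bound)
    also have "\<dots> \<le> (LINT t|lebesgue_on I. M)"
      using True ic ae by (intro integral_mono_AE) auto
    also have "\<dots> = M * d"
      using len by (simp add: measure_restrict_space mult.commute)
    finally show ?thesis .
  next
    case False
    then show ?thesis using assms(1,2) by (simp add: not_integrable_integral_eq)
  qed
  moreover have "cell_avg d q j = integral\<^sup>L (lebesgue_on I) q / d"
    by (simp add: cell_avg_def I_def)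
  ultimately show ?thesis
    using assms(1) by (simp add: abs_divide pos_divide_le_eq)
qed

text \<open>
  Fubini's theorem for null sets. The Lebesgue measure of the plane is only the completion of the
  product measure, so the exceptional set is first enlarged to a Borel null set.
\<close>

lemma AE_lebesgue_pair_swap:
  assumes "AE z in (lebesgue :: (real \<times> real) measure). Q z"
  shows "AE t in lebesgue. AE x in lebesgue. Q (x, t)"
proof -
  have "AE z in (lborel :: real measure) \<Otimes>\<^sub>M (lborel :: real measure). Q z"
    using assms by (simp only: AE_completion_iff lborel_prod)
  then obtain N where N: "{z. \<not> Q z} \<subseteq> N" "N \<in> sets (lborel \<Otimes>\<^sub>M lborel)"
      "emeasure (lborel \<Otimes>\<^sub>M lborel) N = 0"
    by (auto elim!: AE_E simp: space_pair_measure)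
  have "AE z in (lborel :: real measure) \<Otimes>\<^sub>M (lborel :: real measure). z \<notin> N"
    using N by (intro AE_not_in) (auto simp: null_sets_def)
  then have "AE x in lborel. AE t in lborel. (x, t) \<notin> N" by (rule lborel_pair.AE_pair)
  moreover have "{z \<in> space (lborel \<Otimes>\<^sub>M lborel). (fst z, snd z) \<notin> N}
      = space (lborel \<Otimes>\<^sub>M lborel) - N" by auto
  then have "{z \<in> space (lborel \<Otimes>\<^sub>M lborel). (fst z, snd z) \<notin> N} \<in> sets (lborel \<Otimes>\<^sub>M lborel)"
    using N(2) by (metis sets.compl_sets)
  ultimately have "AE t in lborel. AE x in lborel. (x, t) \<notin> N"
    by (subst (asm) lborel_pair.AE_commute) auto
  then have "AE t in lborel. AE x in lborel. Q (x, t)"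
    using N(1) by (auto elim!: eventually_mono)
  then show ?thesis by (simp add: AE_completion_iff)
qed

section \<open>Sobolev embedding for the interpolated control\<close>

text \<open>
  Since \<open>(G\<^sup>2)' = 2 G G' \<le> G\<^sup>2 + G'\<^sup>2\<close>, the values of \<open>G\<^sup>2\<close> at two points differ by at most the squared
  norm \<open>E\<close>. Averaging \<open>G(t)\<^sup>2 \<le> G(s)\<^sup>2 + E\<close> over \<open>s\<close> gives \<open>G(t)\<^sup>2 \<le> (1 / T + 1) E\<close>. The interval is
  open because the interpolant is set to \<open>0\<close> at its right end point.
\<close>

lemma sup_le_W21_norm:
  fixes G G' :: "real \<Rightarrow> real"
  assumes "T > 0" "finite S" "continuous_on {0<..<T} G"
    and der: "\<And>t. t \<in> {0<..<T} - S \<Longrightarrow> (G has_real_derivative G' t) (at t)"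
    and int: "integrable (lebesgue_on {0<..<T}) (\<lambda>t. (G t)\<^sup>2 + (G' t)\<^sup>2)"
    and "t \<in> {0<..<T}"
  shows "\<bar>G t\<bar> \<le> sqrt (1 + 1 / T) * W21_norm T G"
proof -
  define H where "H = (\<lambda>t. (G t)\<^sup>2 + (G' t)\<^sup>2)"
  define E where "E = (LINT t|lebesgue_on {0<..<T}. H t)"
  have W: "W21_norm T G = sqrt E"
  proof -
    have "(LINT t|lebesgue_on {0<..<T}. (G t)\<^sup>2 + (deriv G t)\<^sup>2) = E"
      unfolding E_def
    proof (rule integral_discrete_difference[where X = "S \<inter> {0<..<T}"])
      show "countable (S \<inter> {0<..<T})" using assms(2) by (simp add: countable_finite)
    next
      fix t assume "t \<in> space (lebesgue_on {0<..<T})" "t \<notin> S \<inter> {0<..<T}"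
      then show "(G t)\<^sup>2 + (deriv G t)\<^sup>2 = H t"
        using der[of t] by (auto simp: H_def DERIV_imp_deriv)
    qed (auto simp: emeasure_restrict_space sets_restrict_space_iff)
    then show ?thesis by (simp add: W21_norm_def)
  qed
  have hi: "(H has_integral E) {0<..<T}"
    using int unfolding E_def H_def
    by (intro has_integral_integral_lebesgue_on) auto
  \<comment> \<open>the oscillation of \<open>G\<^sup>2\<close>, from the fundamental theorem of calculus\<close>
  have osc: "(G b)\<^sup>2 - (G a)\<^sup>2 \<le> E \<and> (G a)\<^sup>2 - (G b)\<^sup>2 \<le> E"
    if ab: "0 < a" "a \<le> b" "b < T" for a b
  proof -
    have sub: "{a..b} \<subseteq> {0<..<T}" using ab by auto
    have "((\<lambda>t. 2 * G t * G' t) has_integral (G b)\<^sup>2 - (G a)\<^sup>2) {a..b}"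
    proof (rule fundamental_theorem_of_calculus_strong[OF assms(2) ab(2)])
      fix x assume "x \<in> {a..b} - S"
      with sub der[of x] show "((\<lambda>t. (G t)\<^sup>2) has_vector_derivative 2 * G x * G' x) (at x)"
        unfolding has_real_derivative_iff_has_vector_derivative[symmetric]
        by (auto intro!: derivative_eq_intros)
    qed (use assms(3) sub in \<open>auto intro!: continuous_intros intro: continuous_on_subset\<close>)
    note g = this
    have Hab: "H integrable_on {a..b}"
      using integrable_on_subinterval[of H "{0<..<T}" a b] hi sub by auto
    have "integral {a..b} H \<le> integral {0<..<T} H"
      using sub Hab hi by (intro integral_subset_le) (auto simp: H_def)
    then have le: "integral {a..b} H \<le> E" using hi by (simp add: integral_unique)
    have "2 * G t * G' t \<le> H t" "- (2 * G t * G' t) \<le> H t" for t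
      using sum_squares_bound[of "G t" "G' t"] sum_squares_bound[of "G t" "- G' t"]
      by (auto simp: H_def)
    then have "(G b)\<^sup>2 - (G a)\<^sup>2 \<le> integral {a..b} H" "- ((G b)\<^sup>2 - (G a)\<^sup>2) \<le> integral {a..b} H"
      using has_integral_le[OF g integrable_integral[OF Hab]]
        has_integral_le[OF has_integral_neg[OF g] integrable_integral[OF Hab]] by auto
    with le show ?thesis by linarith
  qed
  have pt: "(G t)\<^sup>2 - E \<le> H s" if "s \<in> {0<..<T}" for s
  proof -
    have "(G t)\<^sup>2 - (G s)\<^sup>2 \<le> E"
      using osc[of s t] osc[of t s] that assms(6) by (cases "s \<le> t") auto
    then show ?thesis using zero_le_power2[of "G' s"] unfolding H_def by linarith
  qed
  \<comment> \<open>integrate over \<open>s\<close> to replace the value at a single point by the integral of \<open>G\<^sup>2\<close>\<close>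
  have "((\<lambda>s. (G t)\<^sup>2 - E) has_integral ((G t)\<^sup>2 - E) * T) {0<..<T}"
    using has_integral_const_real[of "(G t)\<^sup>2 - E" 0 T] assms(1)
    by (simp add: has_integral_Icc_iff_Ioo mult.commute)
  then have "((G t)\<^sup>2 - E) * T \<le> E"
    using hi pt by (rule has_integral_le)
  then have "(G t)\<^sup>2 \<le> (1 + 1 / T) * E"
    using assms(1) by (simp add: field_simps)
  then have "sqrt ((G t)\<^sup>2) \<le> sqrt ((1 + 1 / T) * E)" by (rule real_sqrt_le_mono)
  then show ?thesis by (simp add: W real_sqrt_mult)
qed



lemma grid_cell_unique:
  assumes "\<tau> > 0" "t \<in> {real (j - 1) * \<tau>..<real j * \<tau>}" "t \<in> {real (k - 1) * \<tau>..<real k * \<tau>}"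
  shows "j = k"
proof -
  have "real (j - 1) * \<tau> < real k * \<tau>" "real (k - 1) * \<tau> < real j * \<tau>"
    using assms(2,3) by auto
  then have "j - 1 < k" "k - 1 < j"
    using assms(1) by simp_all
  then show ?thesis by linarith
qed

lemma sum_grid_cells:
  fixes c :: "nat \<Rightarrow> real"
  assumes "\<tau> > 0" "j \<in> {1..n}" "t \<in> {real (j - 1) * \<tau>..<real j * \<tau>}"
  shows "(\<Sum>k=1..n. if t \<in> {real (k - 1) * \<tau>..<real k * \<tau>} then c k else 0) = c j"
proof -
  have "(\<Sum>k=1..n. if t \<in> {real (k - 1) * \<tau>..<real k * \<tau>} then c k else 0)
      = (\<Sum>k=1..n. if k = j then c k else 0)"
  proof (rule sum.cong[OF refl])
    fix k
    show "(if t \<in> {real (k - 1) * \<tau>..<real k * \<tau>} then c k else 0) = (if k = j then c k else 0)"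
      using assms(3) grid_cell_unique[OF assms(1,3), of k] by metis
  qed
  then show ?thesis using assms(2) by simp
qed

lemma grid_cell_exists:
  assumes "\<tau> > 0" "0 \<le> t" "t < real n * \<tau>"
  obtains j where "j \<in> {1..n}" "t \<in> {real (j - 1) * \<tau>..<real j * \<tau>}"
proof
  define i where "i = nat \<lfloor>t / \<tau>\<rfloor>"
  have "0 \<le> t / \<tau>" using assms by simp
  then have "real i \<le> t / \<tau>" "t / \<tau> < real i + 1"
    by (auto simp: i_def)
  then have i: "real i * \<tau> \<le> t" "t < (real i + 1) * \<tau>"
    using assms(1) by (simp_all add: field_simps)
  with assms(3) have "real i * \<tau> < real n * \<tau>" by linarith
  then have "i < n" using assms(1) by simp
  then show "i + 1 \<in> {1..n}" by simp
  show "t \<in> {real (i + 1 - 1) * \<tau>..<real (i + 1) * \<tau>}" using i by (simp add: add.commute)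
qed

text \<open>
  A measurable version of the derivative of the interpolant, which differs from it at the nodes only.
\<close>

definition interp_slope :: "real \<Rightarrow> nat \<Rightarrow> (nat \<Rightarrow> real) \<Rightarrow> real \<Rightarrow> real" where
  "interp_slope T n g t = (\<Sum>k=1..n.
     if t \<in> {real (k - 1) * (T / real n)..<real k * (T / real n)}
     then (g k - g (k - 1)) / (T / real n) else 0)"

lemma interp_on_cell:
  assumes "T > 0" "j \<in> {1..n}" "t \<in> {real (j - 1) * (T / real n)..<real j * (T / real n)}"
  shows "interp T n g t
      = g (j - 1) + (g j - g (j - 1)) / (T / real n) * (t - real (j - 1) * (T / real n))"
    and "interp_slope T n g t = (g j - g (j - 1)) / (T / real n)"
proof -
  have "T / real n > 0" using assms(1,2) by simp
  note * = sum_grid_cells[OF this assms(2,3)]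
  show "interp T n g t
      = g (j - 1) + (g j - g (j - 1)) / (T / real n) * (t - real (j - 1) * (T / real n))"
    unfolding interp_def Let_def by (rule *)
  show "interp_slope T n g t = (g j - g (j - 1)) / (T / real n)"
    unfolding interp_slope_def by (rule *)
qed

text \<open>
  The interpolant is defined on half-open cells. On each closed cell it agrees with one linear
  function, because neighbouring pieces share their value at the common node; the last node, where
  the interpolant is \<open>0\<close>, is repaired by the auxiliary function \<open>G\<close>.
\<close>

lemma continuous_on_interp:
  assumes "T > 0" "n \<ge> 1"
  shows "continuous_on {0..<T} (interp T n g)"
proof -
  define \<tau> where "\<tau> = T / real n"
  have \<tau>: "\<tau> > 0" "real n * \<tau> = T" using assms by (auto simp: \<tau>_def)
  define G where "G = (\<lambda>t. if t < T then interp T n g t else g n)"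
  define L where "L = (\<lambda>j t. g (j - 1) + (g j - g (j - 1)) / \<tau> * (t - real (j - 1) * \<tau>))"
  have len: "real j * \<tau> - real (j - 1) * \<tau> = \<tau>" if "j \<in> {1..n}" for j
    using that by (simp add: of_nat_diff algebra_simps)
  have GL: "G t = L j t" if j: "j \<in> {1..n}" and t: "t \<in> {real (j - 1) * \<tau>..real j * \<tau>}" for j t
  proof -
    have jT: "real j * \<tau> \<le> T" using j \<tau> by (metis atLeastAtMost_iff mult_right_mono of_nat_mono less_imp_le)
    consider "t < real j * \<tau>" | "t = real j * \<tau>" "j = n" | "t = real j * \<tau>" "j + 1 \<in> {1..n}"
      using j t by fastforce
    then show ?thesis
    proof cases
      case 1
      then show ?thesis
        using interp_on_cell(1)[OF assms(1) j, of t] t jT by (simp add: G_def L_def \<tau>_def)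
    next
      case 2
      have "L j t = g j" unfolding L_def 2(1) len[OF j] using \<tau> by simp
      with 2 \<tau> show ?thesis by (simp add: G_def)
    next
      case 3
      have "real (j + 1) * \<tau> \<le> T"
        using 3 \<tau> by (metis atLeastAtMost_iff mult_right_mono of_nat_mono less_imp_le)
      moreover have "real j * \<tau> < real (j + 1) * \<tau>" using \<tau> by simp
      ultimately have "t < T" "t \<in> {real (j + 1 - 1) * \<tau>..<real (j + 1) * \<tau>}" using 3 by auto
      then have "G t = g j"
        using interp_on_cell(1)[OF assms(1) 3(2), of t g] 3 by (simp add: G_def \<tau>_def)
      moreover have "L j t = g j"
        unfolding L_def 3(1) len[OF j] using \<tau> by simp
      ultimately show ?thesis by simp
    qed
  qed
  have "continuous_on (\<Union>j\<in>{1..n}. {real (j - 1) * \<tau>..real j * \<tau>}) G"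
  proof (rule continuous_on_closed_Union)
    fix j assume j: "j \<in> {1..n}"
    have "continuous_on {real (j - 1) * \<tau>..real j * \<tau>} (L j)"
      unfolding L_def by (intro continuous_intros)
    then show "continuous_on {real (j - 1) * \<tau>..real j * \<tau>} G"
      by (rule continuous_on_eq) (use GL[OF j] in metis)
  qed auto
  then have "continuous_on {0..<T} G"
  proof (rule continuous_on_subset, intro subsetI)
    fix t assume t: "t \<in> {0..<T}"
    obtain j where "j \<in> {1..n}" "t \<in> {real (j - 1) * \<tau>..<real j * \<tau>}"
      by (rule grid_cell_exists[of \<tau> t n]) (use \<tau> t in auto)
    then show "t \<in> (\<Union>j\<in>{1..n}. {real (j - 1) * \<tau>..real j * \<tau>})" by force
  qed
  then show ?thesis by (rule continuous_on_eq) (simp add: G_def)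
qed

lemma interp_has_derivative_off_nodes:
  assumes "T > 0" "n \<ge> 1" "t \<in> {0<..<T} - (\<lambda>j. real j * (T / real n)) ` {0..n}"
  shows "(interp T n g has_real_derivative interp_slope T n g t) (at t)"
proof -
  define \<tau> where "\<tau> = T / real n"
  have \<tau>: "\<tau> > 0" "real n * \<tau> = T" using assms by (auto simp: \<tau>_def)
  obtain j where j: "j \<in> {1..n}" "t \<in> {real (j - 1) * \<tau>..<real j * \<tau>}"
    by (rule grid_cell_exists[of \<tau> t n]) (use \<tau> assms(3) in auto)
  have "j - 1 \<in> {0..n}" using j(1) by auto
  with assms(3) have "t \<noteq> real (j - 1) * \<tau>" by (auto simp: \<tau>_def)
  with j have t: "t \<in> {real (j - 1) * \<tau><..<real j * \<tau>}" by auto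
  define L where "L = (\<lambda>t. g (j - 1) + (g j - g (j - 1)) / \<tau> * (t - real (j - 1) * \<tau>))"
  have "(L has_real_derivative interp_slope T n g t) (at t)"
    using interp_on_cell(2)[OF assms(1) j(1), of t g] j(2) unfolding L_def
    by (auto intro!: derivative_eq_intros simp: \<tau>_def)
  then show ?thesis
    by (rule has_field_derivative_transform_within_open[OF _ open_greaterThanLessThan t])
      (use interp_on_cell(1)[OF assms(1) j(1)] in \<open>auto simp: L_def \<tau>_def\<close>)
qed

lemma integrable_interp_energy:
  assumes "T > 0" "n \<ge> 1"
  shows "integrable (lebesgue_on {0<..<T}) (\<lambda>t. (interp T n g t)\<^sup>2 + (interp_slope T n g t)\<^sup>2)"
proof -
  define M where "M = (\<Sum>k=1..n. \<bar>g (k - 1)\<bar> + \<bar>g k - g (k - 1)\<bar>)"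
  define M' where "M' = (\<Sum>k=1..n. \<bar>(g k - g (k - 1)) / (T / real n)\<bar>)"
  have M: "\<bar>interp T n g t\<bar> \<le> M \<and> \<bar>interp_slope T n g t\<bar> \<le> M'" if t: "t \<in> {0<..<T}" for t
  proof -
    define \<tau> where "\<tau> = T / real n"
    have \<tau>: "\<tau> > 0" "real n * \<tau> = T" using assms by (auto simp: \<tau>_def)
    obtain j where j: "j \<in> {1..n}" "t \<in> {real (j - 1) * \<tau>..<real j * \<tau>}"
      by (rule grid_cell_exists[of \<tau> t n]) (use \<tau> t in auto)
    define \<theta> where "\<theta> = (t - real (j - 1) * \<tau>) / \<tau>"
    have "real j * \<tau> = real (j - 1) * \<tau> + \<tau>" using j(1) by (simp add: of_nat_diff algebra_simps)
    then have \<theta>: "0 \<le> \<theta>" "\<theta> \<le> 1"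
      using j(2) \<tau>(1) by (auto simp: \<theta>_def)
    have "interp T n g t = g (j - 1) + (g j - g (j - 1)) * \<theta>"
      using interp_on_cell(1)[OF assms(1) j(1), of t g] j(2) by (simp add: \<tau>_def \<theta>_def)
    also have "\<bar>\<dots>\<bar> \<le> \<bar>g (j - 1)\<bar> + \<bar>g j - g (j - 1)\<bar> * \<theta>"
      using \<theta> by (metis abs_mult abs_of_nonneg abs_triangle_ineq)
    also have "\<dots> \<le> \<bar>g (j - 1)\<bar> + \<bar>g j - g (j - 1)\<bar>"
      using \<theta> by (simp add: mult_left_le)
    also have "\<dots> \<le> M"
      unfolding M_def by (rule member_le_sum[OF j(1)]) auto
    finally have "\<bar>interp T n g t\<bar> \<le> M" .
    moreover have "\<bar>interp_slope T n g t\<bar> \<le> M'"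
      using interp_on_cell(2)[OF assms(1) j(1), of t g] j(2) unfolding M'_def
      using member_le_sum[OF j(1), of "\<lambda>k. \<bar>(g k - g (k - 1)) / (T / real n)\<bar>"]
      by (simp add: \<tau>_def)
    ultimately show ?thesis by simp
  qed
  have meas: "interp T n g \<in> borel_measurable (lebesgue_on {0<..<T})"
      "interp_slope T n g \<in> borel_measurable (lebesgue_on {0<..<T})"
  proof -
    have "interp T n g \<in> borel_measurable borel" "interp_slope T n g \<in> borel_measurable borel"
      unfolding interp_def[abs_def] interp_slope_def[abs_def] Let_def by measurable
    then show "interp T n g \<in> borel_measurable (lebesgue_on {0<..<T})"
      "interp_slope T n g \<in> borel_measurable (lebesgue_on {0<..<T})"
      by (auto intro!: measurable_restrict_space1 measurable_completion)
  qed
  have fm: "finite_measure (lebesgue_on {0<..<T})"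
    using assms(1) by (intro finite_measureI) (auto simp: emeasure_restrict_space)
  show ?thesis
  proof (rule finite_measure.integrable_const_bound[OF fm, where B = "M\<^sup>2 + M'\<^sup>2"])
    show "AE t in lebesgue_on {0<..<T}.
        norm ((interp T n g t)\<^sup>2 + (interp_slope T n g t)\<^sup>2) \<le> M\<^sup>2 + M'\<^sup>2"
    proof (rule AE_I2)
      fix t assume "t \<in> space (lebesgue_on {0<..<T})"
      then have *: "\<bar>interp T n g t\<bar> \<le> M" "\<bar>interp_slope T n g t\<bar> \<le> M'" using M[of t] by auto
      have "(interp T n g t)\<^sup>2 \<le> M\<^sup>2" "(interp_slope T n g t)\<^sup>2 \<le> M'\<^sup>2"
        using *[THEN power_mono, of 2] by auto
      then show "norm ((interp T n g t)\<^sup>2 + (interp_slope T n g t)\<^sup>2) \<le> M\<^sup>2 + M'\<^sup>2" by simp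
    qed
  qed (use meas in measurable)
qed

section \<open>The discrete maximum principle\<close>

lemma deriv_ge_imp_increment_ge:
  fixes f :: "real \<Rightarrow> real"
  assumes "\<And>y. \<exists>d\<ge>c. (f has_real_derivative d) (at y)" "x \<le> y"
  shows "c * (y - x) \<le> f y - f x"
proof -
  have "f x - c * x \<le> f y - c * y"
  proof (rule DERIV_nonneg_imp_nondecreasing[OF assms(2)])
    fix z
    obtain d where "d \<ge> c" "(f has_real_derivative d) (at z)" using assms(1) by blast
    then show "\<exists>e. ((\<lambda>x. f x - c * x) has_real_derivative e) (at z) \<and> 0 \<le> e"
      by (intro exI[of _ "d - c"]) (auto intro!: derivative_eq_intros)
  qed
  then show ?thesis by (simp add: algebra_simps)
qed

text \<open>
  The equations at the nodes result from testing with unit vectors. The weak form has no term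
  \<open>X m * \<eta> m\<close>, so the last equation is a pure flux condition, which ties \<open>y m\<close> to its neighbour.
\<close>

lemma discrete_state_pointwise:
  fixes y X F :: "nat \<Rightarrow> real"
  assumes h: "h > 0" and m: "m \<ge> 1"
    and weak: "\<And>\<eta>. (\<Sum>i<m. h * (X i * \<eta> i + (y (i + 1) - y i) / h * ((\<eta> (i + 1) - \<eta> i) / h)
        - F i * \<eta> i)) - q * \<eta> m + r * \<eta> 0 = 0"
  shows "0 < i \<Longrightarrow> i < m \<Longrightarrow> h * X i = (y (i + 1) - y i) / h - (y i - y (i - 1)) / h + h * F i"
    and "h * X 0 = (y 1 - y 0) / h - r + h * F 0"
    and "(y m - y (m - 1)) / h = q"
proof -
  define e :: "nat \<Rightarrow> nat \<Rightarrow> real" where "e = (\<lambda>i j. if j = i then 1 else 0)"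
  define d where "d = (\<lambda>j. (y (j + 1) - y j) / h)"
  have split: "(\<Sum>j<m. h * (X j * \<eta> j + d j * ((\<eta> (j + 1) - \<eta> j) / h) - F j * \<eta> j))
     = (\<Sum>j<m. (h * X j - h * F j - d j) * \<eta> j) + (\<Sum>j<m. d j * \<eta> (j + 1))" for \<eta>
    unfolding sum.distrib[symmetric] using h by (intro sum.cong) (auto simp: field_simps)
  have s1: "(\<Sum>j<m. c j * e i j) = (if i < m then c i else 0)" for c i
    by (simp add: e_def if_distrib[of "\<lambda>x. _ * x"] cong: if_cong)
  have s2: "(\<Sum>j<m. d j * e i (j + 1)) = (if 0 < i \<and> i \<le> m then d (i - 1) else 0)" for i
  proof (cases i)
    case (Suc i')
    then show ?thesis
      by (simp add: e_def if_distrib[of "\<lambda>x. _ * x"] Suc_le_eq cong: if_cong)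
  qed (simp add: e_def)
  have weak_d: "(\<Sum>j<m. h * (X j * \<eta> j + d j * ((\<eta> (j + 1) - \<eta> j) / h) - F j * \<eta> j))
      - q * \<eta> m + r * \<eta> 0 = 0" for \<eta>
    using weak[of \<eta>] by (simp add: d_def)
  have eq: "(if i < m then h * X i - h * F i - d i else 0)
      + (if 0 < i \<and> i \<le> m then d (i - 1) else 0) - q * e i m + r * e i 0 = 0" for i
    using weak_d[of "e i"] unfolding split s1 s2 .
  { assume i: "0 < i" "i < m"
    then show "h * X i = (y (i + 1) - y i) / h - (y i - y (i - 1)) / h + h * F i"
      using eq[of i] by (simp add: e_def d_def) }
  show "h * X 0 = (y 1 - y 0) / h - r + h * F 0"
    using eq[of 0] m by (simp add: e_def d_def)
  show "(y m - y (m - 1)) / h = q"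
    using eq[of m] m by (simp add: e_def d_def)
qed

text \<open>
  Its derivative is \<open>-2\<close> at \<open>0\<close> and \<open>2\<close> at \<open>l\<close>. The excess over \<open>-1\<close> and \<open>1\<close> leaves room
  for the difference quotients of step \<open>h \<le> l / 2\<close>.
\<close>

definition barrier :: "real \<Rightarrow> real \<Rightarrow> real" where
  "barrier l x = 2 / l * (x - l / 2)\<^sup>2"

text \<open>
  Induction over the time levels. On level \<open>k + 1\<close> let \<open>z\<close> be the excess of the state over the
  comparison function \<open>w\<close>. The flux condition at the right end shows that \<open>z\<close> attains its maximum
  at a node \<open>i1 < m\<close>, where the time difference of \<open>a(v)\<close> occurs. There the space
  differences of \<open>v\<close> are at most those of \<open>w\<close>, hence the time difference quotient is at most
  \<open>M + 4 P / l = c B\<close>. By the lower bound for the increments of \<open>a\<close>, \<open>v\<close> then grows by at most \<open>B \<tau>\<close>, as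
  \<open>w\<close> does, and stays below \<open>w\<close>.
\<close>

lemma discrete_upper_bound:
  fixes a :: "real \<Rightarrow> real" and v F :: "nat \<Rightarrow> nat \<Rightarrow> real"
  assumes "l > 0" "\<tau> > 0" "c > 0" "m \<ge> 2" and h: "h = l / real m"
    and a: "\<And>x y. x \<le> y \<Longrightarrow> c * (y - x) \<le> a y - a x"
    and weak: "\<And>k \<eta>. k \<in> {1..n} \<Longrightarrow>
      (\<Sum>i<m. h * ((a (v k i) - a (v (k - 1) i)) / \<tau> * \<eta> i
          + (v k (i + 1) - v k i) / h * ((\<eta> (i + 1) - \<eta> i) / h) - F i k * \<eta> i))
        - p k * \<eta> m + g k * \<eta> 0 = 0"
    and init: "\<And>i. i \<le> m \<Longrightarrow> v 0 i \<le> A"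
    and F: "\<And>i k. i < m \<Longrightarrow> k \<in> {1..n} \<Longrightarrow> F i k \<le> M"
    and p: "\<And>k. k \<in> {1..n} \<Longrightarrow> p k \<le> P" and g: "\<And>k. k \<in> {1..n} \<Longrightarrow> - g k \<le> P"
    and "M \<ge> 0" "P \<ge> 0"
    and "k \<le> n" "i \<le> m"
  shows "v k i \<le> A + (M + 4 * P / l) / c * (real k * \<tau>) + P * barrier l (real i * h)"
  using \<open>k \<le> n\<close> \<open>i \<le> m\<close>
proof (induction k arbitrary: i)
  case 0
  have "0 \<le> P * barrier l (real i * h)" using assms by (simp add: barrier_def)
  then show ?case using init[OF 0(2)] by simp
next
  case (Suc k)
  define B where "B = (M + 4 * P / l) / c"
  define w where "w = (\<lambda>k i. A + B * (real k * \<tau>) + P * barrier l (real i * h))"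
  define z where "z = (\<lambda>i. v (Suc k) i - w (Suc k) i)"
  have hpos: "h > 0" and hl: "h \<le> l / 2" and mh: "real m * h = l"
    using assms(1,4) by (auto simp: h field_simps)
  have B: "B \<ge> 0" using assms by (simp add: B_def)
  have kn: "Suc k \<in> {1..n}" using Suc.prems by simp
  define X where "X = (\<lambda>i. (a (v (Suc k) i) - a (v k i)) / \<tau>)"
  have weak': "(\<Sum>i<m. h * (X i * \<eta> i
          + (v (Suc k) (i + 1) - v (Suc k) i) / h * ((\<eta> (i + 1) - \<eta> i) / h) - F i (Suc k) * \<eta> i))
        - p (Suc k) * \<eta> m + g (Suc k) * \<eta> 0 = 0" for \<eta>
    using weak[OF kn, of \<eta>] by (simp add: X_def)
  have m1: "m \<ge> 1" using assms(4) by simp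
  note eqs = discrete_state_pointwise[where X = X and y = "v (Suc k)" and F = "\<lambda>i. F i (Suc k)",
      OF hpos m1 weak']
  \<comment> \<open>a node where the time difference is small inherits the bound from the previous level\<close>
  have decr: "h * X i \<le> h * (M + 4 * P / l) \<Longrightarrow> z i \<le> 0" if "i \<le> m" for i
  proof (rule ccontr)
    assume le: "h * X i \<le> h * (M + 4 * P / l)" and "\<not> z i \<le> 0"
    then have "v (Suc k) i > w (Suc k) i" by (simp add: z_def)
    moreover have "v k i \<le> w k i"
      using Suc.IH[of i] Suc.prems that by (simp add: w_def B_def)
    moreover have "w (Suc k) i = w k i + B * \<tau>" by (simp add: w_def algebra_simps)
    ultimately have gt: "v (Suc k) i - v k i > B * \<tau>" by simp
    moreover have "0 \<le> B * \<tau>" using B assms by simp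
    ultimately have "c * (v (Suc k) i - v k i) \<le> a (v (Suc k) i) - a (v k i)"
      by (intro a) simp
    moreover have "c * (B * \<tau>) < c * (v (Suc k) i - v k i)"
      using gt assms(3) by simp
    ultimately have "c * B * \<tau> < a (v (Suc k) i) - a (v k i)" by (simp add: mult.assoc)
    then have "c * B < X i" using assms(2) by (simp add: X_def pos_less_divide_eq)
    then have "M + 4 * P / l < X i" using assms(3) by (simp add: B_def)
    then show False using le hpos by simp
  qed
  have "\<exists>i\<in>{0..m}. \<forall>j\<in>{0..m}. z j \<le> z i"
  proof -
    have "Max (z ` {0..m}) \<in> z ` {0..m}" by (intro Max_in) auto
    then obtain i where "i \<in> {0..m}" "z i = Max (z ` {0..m})" by force
    then show ?thesis by (intro bexI[of _ i]) auto
  qed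
  then obtain i0 where i0: "i0 \<le> m" "\<And>j. j \<le> m \<Longrightarrow> z j \<le> z i0" by auto
  have zd: "v (Suc k) i = z i + w (Suc k) i" for i by (simp add: z_def)
  \<comment> \<open>the slope of the barrier at \<open>l\<close> exceeds the flux \<open>p\<close>, so the last node never exceeds its neighbour\<close>
  have last: "z m \<le> z (m - 1)"
  proof -
    have "real (m - 1) * h = l - h" using mh m1 by (simp add: of_nat_diff algebra_simps)
    then have "w (Suc k) m - w (Suc k) (m - 1) = P * (barrier l l - barrier l (l - h))"
      unfolding w_def mh by (simp add: right_diff_distrib)
    also have "barrier l l - barrier l (l - h) = h * (2 - 2 * h / l)"
      using assms(1) by (simp add: barrier_def field_simps power2_eq_square)
    also have "P * (h * (2 - 2 * h / l)) \<ge> P * (h * 1)"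
      using assms(1) \<open>P \<ge> 0\<close> hpos hl by (intro mult_left_mono) (auto simp: field_simps)
    finally have "P * h \<le> w (Suc k) m - w (Suc k) (m - 1)" by simp
    moreover have "v (Suc k) m - v (Suc k) (m - 1) \<le> P * h"
      using eqs(3) p[OF kn] hpos by (simp add: field_simps)
    ultimately show ?thesis by (simp add: z_def)
  qed
  obtain i1 where i1: "i1 < m" "\<And>j. j \<le> m \<Longrightarrow> z j \<le> z i1"
  proof (cases "i0 = m")
    case True
    then show ?thesis using that[of "m - 1"] i0 last m1 by fastforce
  next
    case False
    then show ?thesis using that[of i0] i0 by simp
  qed
  have "h * X i1 \<le> h * (M + 4 * P / l)"
  proof (cases "i1 = 0")
    case True
    have "w (Suc k) 1 - w (Suc k) 0 = P * (barrier l h - barrier l 0)"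
      by (simp add: w_def algebra_simps)
    also have "barrier l h - barrier l 0 = h * (2 * h / l - 2)"
      using assms(1) by (simp add: barrier_def field_simps power2_eq_square)
    \<comment> \<open>the slope of the barrier at \<open>0\<close> dominates the flux \<open>g\<close>\<close>
    also have "P * (h * (2 * h / l - 2)) \<le> P * (h * (-1))"
      using assms(1) \<open>P \<ge> 0\<close> hpos hl by (intro mult_left_mono) (auto simp: field_simps)
    finally have "w (Suc k) 1 - w (Suc k) 0 \<le> - P * h" by simp
    moreover have "z 1 \<le> z 0" using i1(2)[of 1] m1 True by simp
    ultimately have "v (Suc k) 1 - v (Suc k) 0 \<le> - P * h" unfolding zd by linarith
    then have "(v (Suc k) 1 - v (Suc k) 0) / h \<le> - P"
      using hpos by (simp add: pos_divide_le_eq)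
    moreover have "h * F 0 (Suc k) \<le> h * M"
      using F[OF _ kn, of 0] hpos m1 by simp
    ultimately have "h * X 0 \<le> h * M"
      using eqs(2) g[OF kn] by linarith
    also have "h * M \<le> h * (M + 4 * P / l)" using hpos assms(1) \<open>P \<ge> 0\<close> by simp
    finally show ?thesis using True by simp
  next
    case False
    \<comment> \<open>a second difference of a quadratic polynomial is exact\<close>
    have "w (Suc k) (i1 + 1) - 2 * w (Suc k) i1 + w (Suc k) (i1 - 1)
       = P * (barrier l (real i1 * h + h) - 2 * barrier l (real i1 * h) + barrier l (real i1 * h - h))"
      using False by (simp add: w_def of_nat_diff algebra_simps)
    also have "\<dots> = P * (4 / l) * h\<^sup>2"
      using assms(1) by (simp add: barrier_def field_simps power2_eq_square)
    finally have w2: "w (Suc k) (i1 + 1) - 2 * w (Suc k) i1 + w (Suc k) (i1 - 1) = P * (4 / l) * h\<^sup>2" .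
    have "v (Suc k) (i1 + 1) - 2 * v (Suc k) i1 + v (Suc k) (i1 - 1) \<le> P * (4 / l) * h\<^sup>2"
    proof -
      have "z (i1 + 1) \<le> z i1" "z (i1 - 1) \<le> z i1" using i1(1) by (auto intro: i1(2))
      then have "z (i1 + 1) - 2 * z i1 + z (i1 - 1) \<le> 0" by simp
      moreover have "v (Suc k) (i1 + 1) - 2 * v (Suc k) i1 + v (Suc k) (i1 - 1)
          = (z (i1 + 1) - 2 * z i1 + z (i1 - 1))
            + (w (Suc k) (i1 + 1) - 2 * w (Suc k) i1 + w (Suc k) (i1 - 1))"
        unfolding zd by (simp add: algebra_simps)
      ultimately show ?thesis unfolding w2 by simp
    qed
    then have "(v (Suc k) (i1 + 1) - 2 * v (Suc k) i1 + v (Suc k) (i1 - 1)) / h \<le> P * (4 / l) * h"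
      using hpos by (simp add: pos_divide_le_eq power2_eq_square mult.assoc)
    moreover have "(v (Suc k) (i1 + 1) - v (Suc k) i1) / h - (v (Suc k) i1 - v (Suc k) (i1 - 1)) / h
        = (v (Suc k) (i1 + 1) - 2 * v (Suc k) i1 + v (Suc k) (i1 - 1)) / h"
      by (simp add: diff_divide_distrib add_divide_distrib)
    moreover have "h * F i1 (Suc k) \<le> h * M"
      using F[OF i1(1) kn] hpos by simp
    ultimately have "h * X i1 \<le> P * (4 / l) * h + h * M"
      using eqs(1)[of i1] False i1(1) by simp
    then show ?thesis by (simp add: algebra_simps)
  qed
  then have "z i1 \<le> 0" using decr i1(1) by simp
  then have "z i \<le> 0" using i1(2)[OF Suc.prems(2)] by simp
  then show ?case by (simp add: z_def w_def B_def)
qed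

text \<open>
  Both inequalities are instances of \<open>discrete_upper_bound\<close>; the lower one applies it to \<open>-v\<close>. The
  barrier is at most \<open>l / 2\<close> on the interval, with equality at its ends.
\<close>

lemma discrete_max_bound:
  fixes a :: "real \<Rightarrow> real" and v F :: "nat \<Rightarrow> nat \<Rightarrow> real"
  assumes "l > 0" "T > 0" "n \<ge> 1" "c > 0" "m \<ge> 2" and h: "h = l / real m" and \<tau>: "\<tau> = T / real n"
    and a: "\<And>x y. x \<le> y \<Longrightarrow> c * (y - x) \<le> a y - a x"
    and weak: "\<And>k \<eta>. k \<in> {1..n} \<Longrightarrow>
      (\<Sum>i<m. h * ((a (v k i) - a (v (k - 1) i)) / \<tau> * \<eta> i
          + (v k (i + 1) - v k i) / h * ((\<eta> (i + 1) - \<eta> i) / h) - F i k * \<eta> i))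
        - p k * \<eta> m + g k * \<eta> 0 = 0"
    and init: "\<And>i. i \<le> m \<Longrightarrow> \<bar>v 0 i\<bar> \<le> A"
    and F: "\<And>i k. i < m \<Longrightarrow> k \<in> {1..n} \<Longrightarrow> \<bar>F i k\<bar> \<le> M"
    and p: "\<And>k. k \<in> {1..n} \<Longrightarrow> \<bar>p k\<bar> \<le> P" and g: "\<And>k. k \<in> {1..n} \<Longrightarrow> \<bar>g k\<bar> \<le> P"
    and "M \<ge> 0" "P \<ge> 0" "k \<le> n" "i \<le> m"
  shows "\<bar>v k i\<bar> \<le> A + (M + 4 * P / l) / c * T + P * (l / 2)"
proof -
  have \<tau>0: "\<tau> > 0" using assms by simp
  define W where "W = A + (M + 4 * P / l) / c * (real k * \<tau>) + P * barrier l (real i * h)"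
  have W: "W \<le> A + (M + 4 * P / l) / c * T + P * (l / 2)"
  proof -
    have "real k * \<tau> \<le> T" using assms by (simp add: \<tau> field_simps)
    then have "(M + 4 * P / l) / c * (real k * \<tau>) \<le> (M + 4 * P / l) / c * T"
      using assms by (intro mult_left_mono) auto
    moreover have "barrier l (real i * h) \<le> l / 2"
    proof -
      have "0 \<le> real i * h" "real i * h \<le> l" using assms by (auto simp: h field_simps)
      then have "\<bar>real i * h - l / 2\<bar> \<le> l / 2" by linarith
      then have "(real i * h - l / 2)\<^sup>2 \<le> (l / 2)\<^sup>2"
        using abs_le_square_iff[of "real i * h - l / 2" "l / 2"] assms(1) by simp
      then have "barrier l (real i * h) \<le> 2 / l * (l / 2)\<^sup>2"
        unfolding barrier_def using assms(1) by (intro mult_left_mono) auto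
      then show ?thesis using assms(1) by (simp add: power2_eq_square)
    qed
    then have "P * barrier l (real i * h) \<le> P * (l / 2)"
      using \<open>P \<ge> 0\<close> by (intro mult_left_mono)
    ultimately show ?thesis unfolding W_def by linarith
  qed
  have "v k i \<le> W"
    unfolding W_def
    by (rule discrete_upper_bound[where a = a and F = F and p = p and g = g and v = v and n = n,
          OF assms(1) \<tau>0 assms(4,5) h a weak])
      (use init F p g assms in \<open>auto simp: abs_le_iff\<close>)
  moreover have "- v k i \<le> W"
    unfolding W_def
  proof (rule discrete_upper_bound[OF assms(1) \<tau>0 assms(4,5) h,
        where a = "\<lambda>y. - a (- y)" and F = "\<lambda>i k. - F i k" and p = "\<lambda>k. - p k" and g = "\<lambda>k. - g k"
          and v = "\<lambda>k i. - v k i" and n = n])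
    show "c * (y - x) \<le> - a (- y) - - a (- x)" if "x \<le> y" for x y
      using a[of "- y" "- x"] that by simp
    fix k \<eta> assume k: "k \<in> {1..n}"
    define S where "S = (\<lambda>i. h * ((a (v k i) - a (v (k - 1) i)) / \<tau> * \<eta> i
          + (v k (i + 1) - v k i) / h * ((\<eta> (i + 1) - \<eta> i) / h) - F i k * \<eta> i))"
    have "(\<Sum>i<m. h * ((- a (- (- v k i)) - - a (- (- v (k - 1) i))) / \<tau> * \<eta> i
          + (- v k (i + 1) - - v k i) / h * ((\<eta> (i + 1) - \<eta> i) / h) - - F i k * \<eta> i))
        = (\<Sum>i<m. - S i)"
      by (intro sum.cong refl)
        (simp add: S_def algebra_simps diff_divide_distrib add_divide_distrib)
    also have "\<dots> = - (\<Sum>i<m. S i)" by (rule sum_negf)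
    finally show "(\<Sum>i<m. h * ((- a (- (- v k i)) - - a (- (- v (k - 1) i))) / \<tau> * \<eta> i
          + (- v k (i + 1) - - v k i) / h * ((\<eta> (i + 1) - \<eta> i) / h) - - F i k * \<eta> i))
        - - p k * \<eta> m + - g k * \<eta> 0 = 0"
      using weak[OF k, of \<eta>] by (simp add: S_def)
  qed (use init F p g assms in \<open>auto simp: abs_le_iff\<close>)
  ultimately show ?thesis using W by (simp add: abs_le_iff)
qed

section \<open>The uniform bound\<close>

theorem theorem3:
  fixes l T R a0 b_low :: real
    and J :: nat and u \<gamma> :: "nat \<Rightarrow> real"
    and \<alpha> k b :: "real \<Rightarrow> real"
  defines "D \<equiv> {0<..<l} \<times> {0<..T}"
    and "V \<equiv> (\<lambda>j. F_fun u k (u j)) ` {1..J}"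
  assumes "l > 0" "T > 0" "R > 0" "J \<ge> 1"
    and "strict_mono_on {1..J} u"
    and "\<forall>j\<in>{1..J}. \<gamma> j > 0"
    and "piecewise_C1_pos J u \<alpha>" "piecewise_C1_pos J u k"
    and "\<forall>j\<in>{1..J}. \<exists>d. d \<noteq> 0 \<and> has_jump \<alpha> (u j) d"
    and "\<forall>j\<in>{1..J}. \<exists>d. d \<noteq> 0 \<and> has_jump k (u j) d"
    and "filterlim (F_fun u k) at_top at_top"
    and "a0 > 0" "Liminf at_top (\<lambda>x. ereal (\<alpha> x / k x)) \<ge> ereal a0"
    and "\<forall>y\<in>range (F_fun u k) - V. (b has_real_derivative beta_fun u \<alpha> k y) (at y)"
    and "\<forall>j\<in>{1..J}. has_jump b (F_fun u k (u j)) (\<gamma> j)"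
    and "b_low > 0"
    and "\<forall>y. y \<notin> V \<longrightarrow> (\<exists>d\<ge>b_low. (b has_real_derivative d) (at y))"
    and "\<forall>n\<ge>1. \<forall>y. \<exists>d\<ge>b_low. (mollify b n has_real_derivative d) (at y)"
  shows "\<exists>C>0. \<forall>(p :: real \<Rightarrow> real) (\<Phi> :: real \<Rightarrow> real) (f :: real \<times> real \<Rightarrow> real).
    in_Linf {0<..<T} p \<longrightarrow> in_Linf {0<..<l} \<Phi> \<longrightarrow> in_Linf D f \<longrightarrow>
    (\<forall>y\<in>V. {x\<in>{0..l}. \<Phi> x = y} \<in> null_sets lebesgue) \<longrightarrow>
    \<bar>\<Phi> l\<bar> \<le> Linf_norm {0<..<l} \<Phi> \<longrightarrow>
    (\<exists>N. \<forall>n\<ge>N. \<forall>m\<ge>N. \<forall>g\<in>control_set T R n. \<forall>v.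
       discrete_state_vector l T b p \<Phi> f n m g v \<longrightarrow>
       linf_norm n m v \<le> C * (Linf_norm D f + Linf_norm {0<..<T} p
         + W21_norm T (interp T n g) + Linf_norm {0<..<l} \<Phi>))"
proof -
  \<comment> \<open>\<open>c\<^sub>S\<close> is the constant of the Sobolev embedding, and \<open>\<kappa>\<close> collects the coefficients of \<open>P\<close> in
      the bound of \<open>discrete_max_bound\<close> with \<open>c = b_low\<close>\<close>
  define c\<^sub>S where "c\<^sub>S = sqrt (1 + 1 / T)"
  define \<kappa> where "\<kappa> = 4 * T / (l * b_low) + l / 2"
  define C where "C = 1 + T / b_low + (1 + c\<^sub>S) * \<kappa>"
  have c\<^sub>S: "c\<^sub>S \<ge> 0" and \<kappa>: "\<kappa> \<ge> 0" and C0: "C > 0"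
    using \<open>l > 0\<close> \<open>T > 0\<close> \<open>b_low > 0\<close>
    by (auto simp: c\<^sub>S_def \<kappa>_def C_def intro!: add_pos_nonneg mult_nonneg_nonneg)
  have bound: "linf_norm n m v \<le> C * (Linf_norm D f + Linf_norm {0<..<T} p
         + W21_norm T (interp T n g) + Linf_norm {0<..<l} \<Phi>)"
    if p: "in_Linf {0<..<T} p" and \<Phi>: "in_Linf {0<..<l} \<Phi>" and f: "in_Linf D f"
      and \<Phi>l: "\<bar>\<Phi> l\<bar> \<le> Linf_norm {0<..<l} \<Phi>"
      and nm: "n \<ge> 2" "m \<ge> 2" and v: "discrete_state_vector l T b p \<Phi> f n m g v"
    for p \<Phi> :: "real \<Rightarrow> real" and f :: "real \<times> real \<Rightarrow> real" and n m g v
  proof -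
    define \<tau> h where "\<tau> = T / real n" and "h = l / real m"
    define M A W P where "M = Linf_norm D f" and "A = Linf_norm {0<..<l} \<Phi>"
      and "W = W21_norm T (interp T n g)" and "P = Linf_norm {0<..<T} p + c\<^sub>S * W"
    have \<tau>: "\<tau> > 0" "real n * \<tau> = T" and h: "h > 0" "real m * h = l"
      using nm \<open>T > 0\<close> \<open>l > 0\<close> by (auto simp: \<tau>_def h_def)
    have D: "D \<in> sets lebesgue"
      unfolding D_def by (rule sets_completionI_sets) (auto intro: borel_Times)
    have W0: "W \<ge> 0"
      unfolding W_def W21_norm_def by (auto intro!: integral_nonneg_AE)
    have nn: "M \<ge> 0" "A \<ge> 0" "Linf_norm {0<..<T} p \<ge> 0"
      by (auto simp: M_def A_def intro!: Linf_norm_nonneg)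
    have P0: "P \<ge> 0" using nn W0 c\<^sub>S by (simp add: P_def)
    have time: "{real (k - 1) * \<tau><..<(real (k - 1) + 1) * \<tau>} \<subseteq> {0<..<T}" if "k \<in> {1..n}" for k
    proof -
      have "(real (k - 1) + 1) * \<tau> \<le> real n * \<tau>"
        using that \<tau>(1) by (intro mult_right_mono) (auto simp: of_nat_diff)
      moreover have "0 \<le> real (k - 1) * \<tau>" using \<tau> by simp
      ultimately show ?thesis unfolding \<tau>(2) by (auto simp only: greaterThanLessThan_iff)
    qed
    have space: "{real i * h<..<(real i + 1) * h} \<subseteq> {0<..<l}" if "i < m" for i
    proof -
      have "(real i + 1) * h \<le> real m * h"
        using that h(1) by (intro mult_right_mono) auto
      moreover have "0 \<le> real i * h" using h by simp
      ultimately show ?thesis unfolding h(2) by (auto simp only: greaterThanLessThan_iff)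
    qed
    have init: "\<bar>v 0 i\<bar> \<le> A" if "i \<le> m" for i
    proof (cases "i = m")
      case True
      then show ?thesis using v \<Phi>l by (simp add: discrete_state_vector_def Let_def A_def)
    next
      case False
      with that have i: "i < m" by simp
      have "\<bar>cell_avg h \<Phi> i\<bar> \<le> A"
      proof (rule abs_cell_avg_le[OF h(1) nn(2)])
        show "AE x in lebesgue. x \<in> {real i * h<..<(real i + 1) * h} \<longrightarrow> \<bar>\<Phi> x\<bar> \<le> A"
          using AE_abs_le_Linf_norm[OF \<Phi>] space[OF i] by (auto simp: A_def elim!: eventually_mono)
      qed
      then show ?thesis using v i by (simp add: discrete_state_vector_def Let_def h_def)
    qed
    have pk: "\<bar>cell_avg \<tau> p (k - 1)\<bar> \<le> P" if k: "k \<in> {1..n}" for k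
    proof -
      have "\<bar>cell_avg \<tau> p (k - 1)\<bar> \<le> Linf_norm {0<..<T} p"
      proof (rule abs_cell_avg_le[OF \<tau>(1) nn(3)])
        show "AE t in lebesgue. t \<in> {real (k - 1) * \<tau><..<(real (k - 1) + 1) * \<tau>}
            \<longrightarrow> \<bar>p t\<bar> \<le> Linf_norm {0<..<T} p"
          using AE_abs_le_Linf_norm[OF p] time[OF k] by (auto elim!: eventually_mono)
      qed
      then show ?thesis using c\<^sub>S W0 by (simp add: P_def add_increasing2)
    qed
    have gk: "\<bar>cell_avg \<tau> (interp T n g) (k - 1)\<bar> \<le> P" if k: "k \<in> {1..n}" for k
    proof -
      have "n \<ge> 1" using nm by simp
      have "\<bar>interp T n g t\<bar> \<le> c\<^sub>S * W" if "t \<in> {0<..<T}" for t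
        unfolding c\<^sub>S_def W_def
      proof (rule sup_le_W21_norm[OF \<open>T > 0\<close> _ _ _ integrable_interp_energy that])
        show "continuous_on {0<..<T} (interp T n g)"
          by (rule continuous_on_subset[OF continuous_on_interp]) (use \<open>T > 0\<close> \<open>n \<ge> 1\<close> in auto)
        show "(interp T n g has_real_derivative interp_slope T n g s) (at s)"
          if "s \<in> {0<..<T} - (\<lambda>j. real j * (T / real n)) ` {0..n}" for s
          by (rule interp_has_derivative_off_nodes[OF \<open>T > 0\<close> \<open>n \<ge> 1\<close> that])
      qed (use \<open>T > 0\<close> \<open>n \<ge> 1\<close> in auto)
      then have "\<bar>cell_avg \<tau> (interp T n g) (k - 1)\<bar> \<le> c\<^sub>S * W"
        using time[OF k] c\<^sub>S W0 by (intro abs_cell_avg_le[OF \<tau>(1)] AE_I2) auto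
      then show ?thesis using nn(3) by (simp add: P_def)
    qed
    have fik: "\<bar>cell_avg \<tau> (\<lambda>t. cell_avg h (\<lambda>x. f (x, t)) i) (k - 1)\<bar> \<le> M"
      if i: "i < m" and k: "k \<in> {1..n}" for i k
    proof (rule abs_cell_avg_le[OF \<tau>(1) nn(1)])
      have "AE t in lebesgue. AE x in lebesgue. (x, t) \<in> D \<longrightarrow> \<bar>f (x, t)\<bar> \<le> M"
        unfolding M_def by (rule AE_lebesgue_pair_swap) (rule AE_abs_le_Linf_norm[OF f D])
      then show "AE t in lebesgue. t \<in> {real (k - 1) * \<tau><..<(real (k - 1) + 1) * \<tau>}
          \<longrightarrow> \<bar>cell_avg h (\<lambda>x. f (x, t)) i\<bar> \<le> M"
      proof eventually_elim
        case (elim t)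
        show ?case
        proof
          assume "t \<in> {real (k - 1) * \<tau><..<(real (k - 1) + 1) * \<tau>}"
          then have t: "t \<in> {0<..T}" using time[OF k] by auto
          show "\<bar>cell_avg h (\<lambda>x. f (x, t)) i\<bar> \<le> M"
          proof (rule abs_cell_avg_le[OF h(1) nn(1)])
            show "AE x in lebesgue. x \<in> {real i * h<..<(real i + 1) * h} \<longrightarrow> \<bar>f (x, t)\<bar> \<le> M"
              using elim by eventually_elim (use t space[OF i] in \<open>auto simp: D_def\<close>)
          qed
        qed
      qed
    qed
    have incr: "b_low * (y - x) \<le> mollify b n y - mollify b n x" if "x \<le> y" for x y
      using assms(20) nm that by (intro deriv_ge_imp_increment_ge) auto
    have weak: "(\<Sum>i<m. h * ((mollify b n (v k i) - mollify b n (v (k - 1) i)) / \<tau> * \<eta> i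
          + (v k (i + 1) - v k i) / h * ((\<eta> (i + 1) - \<eta> i) / h)
          - cell_avg \<tau> (\<lambda>t. cell_avg h (\<lambda>x. f (x, t)) i) (k - 1) * \<eta> i))
        - cell_avg \<tau> p (k - 1) * \<eta> m + cell_avg \<tau> (interp T n g) (k - 1) * \<eta> 0 = 0"
      if "k \<in> {1..n}" for k \<eta>
      using v that unfolding discrete_state_vector_def Let_def \<tau>_def h_def by blast
    have "\<bar>v k i\<bar> \<le> A + (M + 4 * P / l) / b_low * T + P * (l / 2)" if "k \<le> n" "i \<le> m" for k i
      by (rule discrete_max_bound[where a = "mollify b n" and v = v and n = n and m = m
            and F = "\<lambda>i k. cell_avg \<tau> (\<lambda>t. cell_avg h (\<lambda>x. f (x, t)) i) (k - 1)"
            and p = "\<lambda>k. cell_avg \<tau> p (k - 1)"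
            and g = "\<lambda>k. cell_avg \<tau> (interp T n g) (k - 1)",
            OF \<open>l > 0\<close> \<open>T > 0\<close> _ \<open>b_low > 0\<close> nm(2) h_def \<tau>_def incr weak])
        (use nm init fik pk gk nn P0 that in auto)
    then have "linf_norm n m v \<le> A + (M + 4 * P / l) / b_low * T + P * (l / 2)"
      unfolding linf_norm_def by (subst Max_le_iff; force)
    also have "\<dots> = A + T / b_low * M + \<kappa> * P"
      using \<open>l > 0\<close> \<open>b_low > 0\<close> by (simp add: \<kappa>_def field_simps)
    also have "\<dots> \<le> C * A + C * M + C * (Linf_norm {0<..<T} p + W)"
    proof -
      have "1 \<le> C" "T / b_low \<le> C" "\<kappa> * (1 + c\<^sub>S) \<le> C"
        using \<open>T > 0\<close> \<open>b_low > 0\<close> \<kappa> c\<^sub>S by (auto simp: C_def algebra_simps add_nonneg_nonneg)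
      moreover have "P \<le> (1 + c\<^sub>S) * (Linf_norm {0<..<T} p + W)"
        using nn W0 c\<^sub>S by (simp add: P_def algebra_simps)
      then have "\<kappa> * P \<le> \<kappa> * (1 + c\<^sub>S) * (Linf_norm {0<..<T} p + W)"
        using \<kappa> by (simp add: mult_left_mono mult.assoc)
      ultimately show ?thesis
        using mult_right_mono[of 1 C A] mult_right_mono[of "T / b_low" C M]
          mult_right_mono[of "\<kappa> * (1 + c\<^sub>S)" C "Linf_norm {0<..<T} p + W"] nn W0
        by linarith
    qed
    also have "\<dots> = C * (M + Linf_norm {0<..<T} p + W + A)" by (simp add: algebra_simps)
    finally show ?thesis by (simp add: M_def A_def W_def)
  qed
  \<comment> \<open>\<open>m \<ge> 2\<close> is the condition \<open>h \<le> l / 2\<close> under which the barrier works\<close>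
  show ?thesis
    by (intro exI[of _ C] conjI C0 allI impI exI[of _ 2] ballI bound)
qed

end
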